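(* Let $a,b,c$ be positive numbers with $a<b<c$, $b-a<c_0<a$, $0<c_1<2a-b$ and $\lfloor c/b\rfloor\ge2$, where $c_0=c-\lfloor c/b\rfloor b$ and $c_1=\lfloor c/b\rfloor b-\lfloor\lfloor c/b\rfloor b/a\rfloor a$. Suppose $\mathcal S_{a,b,c}\ne\emptyset$ and either $a/b\notin\mathbb Q$, or $a/b=p/q$ and $c/b\in\mathbb Z/q$ for some coprime positive integers $p,q$. Then $\mathcal D_{a,b,c}=\emptyset$ if and only if $$(\lfloor c/b\rfloor+1)\,|\mathcal S_{a,b,c}\cap[0,c_0+a-b)|+\lfloor c/b\rfloor\,|\mathcal S_{a,b,c}\cap[c_0,a)|=a,$$ where $|\cdot|$ denotes Lebesgue measure.
   Context: For $a,b,c>0$ and $t\in\mathbb R$, $\mathbf M_{a,b,c}(t)=(\chi_{[0,c)}(t-\mu+\lambda))_{\mu\in a\mathbb Z,\lambda\in b\mathbb Z}$ is the infinite matrix with rows indexed by $a\mathbb Z$ and columns by $b\mathbb Z$, acting by $(\mathbf M_{a,b,c}(t)\mathbf x)(\mu)=\sum_{\lambda\in b\mathbb Z}\chi_{[0,c)}(t-\mu+\lambda)\mathbf x(\lambda)$. $\mathcal B_b^0$ is the set of vectors $(\mathbf x(\lambda))_{\lambda\in b\mathbb Z}$ with entries in $\{0,1\}$ and $\mathbf x(0)=1$. $\mathbf 1,\mathbf 2$ denote the vectors indexed by $a\mathbb Z$ with all entries $1$, resp. $2$. $\mathcal D_{a,b,c}=\{t:\mathbf M_{a,b,c}(t)\mathbf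 x=\mathbf 2\text{ for some }\mathbf x\in\mathcal B_b^0\}$, $\mathcal S_{a,b,c}=\{t:\mathbf M_{a,b,c}(t)\mathbf x=\mathbf 1\text{ for some }\mathbf x\in\mathcal B_b^0\}$. *)

theory Defs
  imports "HOL-Analysis.Analysis"
begin

text \<open>Rows are indexed by m :: int (standing for mu = m*a), columns by n :: int
  (standing for lambda = n*b). The entry is the indicator of [0,c) at t - mu + lambda.\<close>

definition Mmat :: "real \<Rightarrow> real \<Rightarrow> real \<Rightarrow> real \<Rightarrow> int \<Rightarrow> int \<Rightarrow> real" where
  "Mmat a b c t m n = indicator {0..<c} (t - of_int m * a + of_int n * b)"

text \<open>Matrix-vector product; only finitely many entries of a row are nonzero since c is finite.\<close>
definition Mapply :: "real \<Rightarrow> real \<Rightarrow> real \<Rightarrow> real \<Rightarrow> (int \<Rightarrow> real) \<Rightarrow> int \<Rightarrow> real" where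
  "Mapply a b c t x m =
     (\<Sum>n\<in>{n::int. Mmat a b c t m n \<noteq> 0}. Mmat a b c t m n * x n)"

definition B0 :: "(int \<Rightarrow> real) set" where
  "B0 = {x. (\<forall>n. x n = 0 \<or> x n = 1) \<and> x 0 = 1}"

definition Dset :: "real \<Rightarrow> real \<Rightarrow> real \<Rightarrow> real set" where
  "Dset a b c = {t. \<exists>x\<in>B0. \<forall>m. Mapply a b c t x m = 2}"

definition Sset :: "real \<Rightarrow> real \<Rightarrow> real \<Rightarrow> real set" where
  "Sset a b c = {t. \<exists>x\<in>B0. \<forall>m. Mapply a b c t x m = 1}"

end

theory Submission
  imports Defs
begin

text \<open>
  A set of points of \<open>t + b\<int>\<close> meeting every window \<open>[ma, ma + c)\<close> in a constant number of
  points is closed under the partial injection \<open>R\<close> sending \<open>y\<close> to \<open>y + (k + 1)b\<close> if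
  \<open>y mod a < c\<^sub>0 + a - b\<close>, to \<open>y + kb\<close> if \<open>y mod a \<ge> c\<^sub>0\<close>, and under its inverse.
  A single bi-infinite orbit of \<open>R\<close> meets every window once, so \<open>S\<close> is the set of points with a
  bi-infinite orbit, and \<open>D\<close> is empty iff no coset of \<open>b\<int>\<close> contains two orbits.
  The left-hand side of the measure identity is \<open>\<integral> (R y - y) / b\<close> over one period of \<open>S\<close>, that is,
  the integral over a period of the number of orbits in \<open>x + b\<int>\<close>.

  Both \<open>S\<close> and \<open>D\<close> are decreasing intersections of \<open>a\<close>-periodic finite unions of half-open
  intervals. Such a union containing \<open>t + b\<int>\<close> is the whole line, by density of \<open>a\<int> + b\<int>\<close> or,
  in the commensurable case, because all endpoints lie on the grid \<open>a\<int> + b\<int>\<close>. With a pigeonhole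
  argument over the \<open>k + 1\<close> translates this shows that one orbit in \<open>S\<close> forces every coset to contain
  an orbit, and one point of \<open>D\<close> forces \<open>D\<close> to have positive measure. Hence the integral is \<open>a\<close>
  exactly when \<open>D\<close> is empty.
\<close>

section \<open>Integer sequences, floors and periodic sets\<close>

lemma int_orbit_exists:
  fixes n0 :: 'a
  assumes "n0 \<in> G"
    and fwd: "\<And>n. n \<in> G \<Longrightarrow> \<exists>n'\<in>G. P n n'"
    and bwd: "\<And>n. n \<in> G \<Longrightarrow> \<exists>n'\<in>G. P n' n"
  shows "\<exists>z :: int \<Rightarrow> 'a. z 0 = n0 \<and> range z \<subseteq> G \<and> (\<forall>i. P (z i) (z (i + 1)))"
proof -
  obtain f where f: "\<And>n. n \<in> G \<Longrightarrow> f n \<in> G \<and> P n (f n)" using fwd by metis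
  obtain g where g: "\<And>n. n \<in> G \<Longrightarrow> g n \<in> G \<and> P (g n) n" using bwd by metis
  have fG: "(f ^^ i) n0 \<in> G" for i by (induction i) (use assms(1) f in auto)
  have gG: "(g ^^ i) n0 \<in> G" for i by (induction i) (use assms(1) g in auto)
  \<comment> \<open>\<open>f\<close> and \<open>g\<close> select a successor and a predecessor
    inside \<open>G\<close>; nonnegative indices iterate \<open>f\<close>, negative ones iterate
    \<open>g\<close>, and both halves start at \<open>n0\<close>.\<close>
  define z where "z i = (if i \<ge> 0 then (f ^^ nat i) n0 else (g ^^ nat (-i)) n0)" for i :: int
  have "P (z i) (z (i + 1))" for i
  proof (cases "i \<ge> 0")
    case True
    then have "nat (i + 1) = Suc (nat i)" by simp
    then show ?thesis using True f[OF fG[of "nat i"]] by (simp add: z_def)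
  next
    case False
    then have "nat (- i) = Suc (nat (- (i + 1)))" by simp
    then have "z i = g (z (i + 1))" using False by (auto simp: z_def)
    moreover have "z (i + 1) \<in> G" using fG gG by (simp add: z_def)
    ultimately show ?thesis using g by simp
  qed
  moreover have "z i \<in> G" for i using fG gG by (simp add: z_def)
  moreover have "z 0 = n0" by (simp add: z_def)
  ultimately show ?thesis by blast
qed

text \<open>A strictly increasing integer sequence moves by at least 1 per step, so it is unbounded
  in both directions and has to cross \<open>r\<close> somewhere.\<close>

lemma int_increasing_sequence_brackets:
  fixes z :: "int \<Rightarrow> int"
  assumes inc: "\<And>i. z i < z (i + 1)"
  obtains i where "z i \<le> r" "r < z (i + 1)"
proof -
  have down: "z (- int n) \<le> z 0 - int n" for n
  proof (induction n)
    case (Suc n)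
    have "- int (Suc n) + 1 = - int n" by simp
    then show ?case using Suc inc[of "- int (Suc n)"] by simp
  qed simp
  \<comment> \<open>Going back \<open>z 0 - r\<close> steps suffices to get below \<open>r\<close>;
    \<open>nat\<close> truncates to 0 when \<open>z 0\<close> is already there.\<close>
  define i0 where "i0 = - int (nat (z 0 - r))"
  have i0: "z i0 \<le> r" using down[of "nat (z 0 - r)"] unfolding i0_def by linarith
  define P where "P n \<longleftrightarrow> r < z (i0 + int n)" for n
  have up: "z i0 + int n \<le> z (i0 + int n)" for n
  proof (induction n)
    case (Suc n)
    show ?case using Suc inc[of "i0 + int n"] by (simp add: algebra_simps)
  qed simp
  have "P (nat (r - z i0 + 1))" unfolding P_def using up[of "nat (r - z i0 + 1)"] i0 by simp
  moreover have "\<not> P 0" unfolding P_def using i0 by simp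
  moreover have "P n \<Longrightarrow> \<not> P 0 \<Longrightarrow> \<exists>n. \<not> P n \<and> P (Suc n)" for n by (induction n) auto
  ultimately obtain n where "\<not> P n" "P (Suc n)" by blast
  then show ?thesis using that[of "i0 + int n"] unfolding P_def by (simp add: algebra_simps)
qed

lemma strict_mono_int_if_step:
  fixes z :: "int \<Rightarrow> 'a::order"
  assumes "\<And>i. z i < z (i + 1)"
  shows "strict_mono z"
proof (rule strict_monoI)
  fix i j :: int assume "i < j"
  then show "z i < z j"
    by (induction rule: int_gr_induct) (use assms less_trans in blast)+
qed

text \<open>Pigeonhole: if every \<open>j\<close> failed at some level, all of them would fail at
  the largest of these finitely many levels. It moves a finite choice out of a decreasing
  intersection.\<close>

lemma decseq_finite_choice:
  fixes A :: "nat \<Rightarrow> 'i \<Rightarrow> bool"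
  assumes "finite J" and ex: "\<And>N. \<exists>j\<in>J. A N j" and dec: "\<And>N j. A (Suc N) j \<Longrightarrow> A N j"
  shows "\<exists>j\<in>J. \<forall>N. A N j"
proof (rule ccontr)
  assume "\<not> ?thesis"
  then obtain n where n: "\<And>j. j \<in> J \<Longrightarrow> \<not> A (n j) j" by metis
  obtain M where M: "\<And>j. j \<in> J \<Longrightarrow> n j \<le> M"
    using assms(1) by (metis finite_imageI finite_nat_set_iff_bounded_le imageI)
  have anti: "A N j \<Longrightarrow> N' \<le> N \<Longrightarrow> A N' j" for N N' j
    by (induction N) (use dec le_Suc_eq in auto)
  obtain j where "j \<in> J" "A M j" using ex by blast
  then show False using n M anti by blast
qed

lemma floor_divide_eq_iff:
  fixes a :: real
  assumes "0 < a"
  shows "\<lfloor>y / a\<rfloor> = m \<longleftrightarrow> of_int m * a \<le> y \<and> y < of_int m * a + a"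
  using assms by (simp add: floor_eq_iff field_simps)

lemma floor_divide_eventually_right_constant:
  fixes a :: real
  assumes "0 < a"
  shows "\<exists>e>0. \<forall>y. x \<le> y \<and> y < x + e \<longrightarrow> \<lfloor>(y + s) / a\<rfloor> = \<lfloor>(x + s) / a\<rfloor>"
proof -
  define m where "m = \<lfloor>(x + s) / a\<rfloor>"
  have m: "of_int m * a \<le> x + s" "x + s < of_int m * a + a"
    using m_def floor_divide_eq_iff[OF assms] by blast+
  show ?thesis unfolding m_def[symmetric]
    by (rule exI[of _ "of_int m * a + a - (x + s)"]) (use m assms in \<open>auto simp: floor_divide_eq_iff\<close>)
qed

lemma periodic_int_multiple:
  fixes a :: real
  assumes "\<And>x. x + a \<in> V \<longleftrightarrow> x \<in> V"
  shows "x + of_int n * a \<in> V \<longleftrightarrow> x \<in> V"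
proof -
  have *: "x + real n * a \<in> V \<longleftrightarrow> x \<in> V" for x n
  proof (induction n)
    case (Suc n)
    then show ?case using assms[of "x + real n * a"] by (simp add: algebra_simps)
  qed simp
  show ?thesis using *[of x "nat n"] *[of "x + of_int n * a" "nat (-n)"] by (cases "n \<ge> 0") auto
qed

text \<open>Periodicity reduces \<open>s\<close> to its remainder \<open>r\<close> modulo
  \<open>a\<close>. The translate then fills \<open>[r, a + r)\<close>, and its part beyond
  \<open>a\<close> is moved back to \<open>[0, r)\<close>.\<close>

lemma measure_period_translate:
  fixes V :: "real set"
  assumes "0 < a" and V: "V \<in> sets borel" and per: "\<And>x. x + a \<in> V \<longleftrightarrow> x \<in> V"
  shows "measure lebesgue ({x. x + s \<in> V} \<inter> {0..<a}) = measure lebesgue (V \<inter> {0..<a})"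
proof -
  define r where "r = s - of_int \<lfloor>s / a\<rfloor> * a"
  have r: "0 \<le> r" "r < a"
    using floor_divide_eq_iff[OF assms(1), of s "\<lfloor>s / a\<rfloor>"] by (auto simp: r_def)
  have sr: "x + s \<in> V \<longleftrightarrow> x + r \<in> V" for x
    using periodic_int_multiple[of a V "x + r" "\<lfloor>s / a\<rfloor>", OF per] by (simp add: r_def algebra_simps)
  have fm: "V \<inter> {u..<v} \<in> lmeasurable" for u v
  proof (rule fmeasurableI2)
    show "{u..v} \<in> lmeasurable" by simp
  qed (use V in auto)
  have "measure lebesgue ({x. x + s \<in> V} \<inter> {0..<a}) = measure lebesgue ((+) r ` ({x. x + s \<in> V} \<inter> {0..<a}))"
    by (simp add: measure_translation)
  also have "(+) r ` ({x. x + s \<in> V} \<inter> {0..<a}) = V \<inter> {r..<a + r}"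
  proof (intro equalityI subsetI)
    fix x assume "x \<in> V \<inter> {r..<a + r}"
    then show "x \<in> (+) r ` ({x. x + s \<in> V} \<inter> {0..<a})"
      by (intro image_eqI[of _ _ "x - r"]) (auto simp: sr)
  qed (auto simp: sr add.commute)
  also have "V \<inter> {r..<a + r} = (V \<inter> {r..<a}) \<union> (V \<inter> {a..<a + r})" using r by auto
  also have "measure lebesgue \<dots> = measure lebesgue (V \<inter> {r..<a}) + measure lebesgue (V \<inter> {a..<a + r})"
    by (rule measure_Un2[OF fm fm, THEN trans]) (auto intro!: arg_cong[where f="measure lebesgue"])
  also have "V \<inter> {a..<a + r} = (+) a ` (V \<inter> {0..<r})"
  proof (intro equalityI subsetI)
    fix x assume "x \<in> V \<inter> {a..<a + r}"
    then show "x \<in> (+) a ` (V \<inter> {0..<r})"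
      using per[of "x - a"] by (intro image_eqI[of _ _ "x - a"]) auto
  qed (auto simp: per add.commute)
  also have "measure lebesgue \<dots> = measure lebesgue (V \<inter> {0..<r})" by (rule measure_translation)
  also have "measure lebesgue (V \<inter> {r..<a}) + \<dots> = measure lebesgue ((V \<inter> {0..<r}) \<union> (V \<inter> {r..<a}))"
    by (subst measure_Un2[OF fm fm]) (auto intro!: arg_cong[where f="measure lebesgue"])
  also have "(V \<inter> {0..<r}) \<union> (V \<inter> {r..<a}) = V \<inter> {0..<a}" using r by auto
  finally show ?thesis .
qed

section \<open>Orbits of the jump map\<close>

text \<open>The bounds on \<open>c - of_int k * b\<close>, which is the number \<open>c0\<close>,
  force \<open>k\<close> to be the floor of \<open>c / b\<close>. In each period they leave a gap of
  length \<open>b - a\<close> between the two residue ranges on which a jump exists.\<close>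

locale window_count =
  fixes a b c :: real and k :: int
  assumes a_pos: "0 < a" and a_less_b: "a < b"
    and c0_gt: "b - a < c - of_int k * b" and c0_less: "c - of_int k * b < a"
    and k_pos: "1 \<le> k"
begin

text \<open>When every window \<open>[ma, ma + c)\<close> contains the same number of points of a set
  \<open>X \<subseteq> t + b\<int>\<close>, sliding the window from \<open>m\<close> to \<open>m + 1\<close> trades the
  point \<open>y\<close> in \<open>[ma, ma + a)\<close> for a point \<open>y + jb\<close> in \<open>[ma + c, ma + a + c)\<close>.\<close>

definition jump :: "real \<Rightarrow> int \<Rightarrow> bool" where
  "jump y j \<longleftrightarrow> \<lfloor>(y + of_int j * b - c) / a\<rfloor> = \<lfloor>y / a\<rfloor>"

lemma b_pos: "0 < b" using a_pos a_less_b by simp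

lemma int_multiple_eq_0: "\<bar>of_int n * b\<bar> < a \<Longrightarrow> n = 0" for n :: int
proof (rule ccontr)
  assume "\<bar>of_int n * b\<bar> < a" "n \<noteq> 0"
  then have "1 \<le> \<bar>real_of_int n\<bar>" by linarith
  then have "b \<le> \<bar>of_int n * b\<bar>" using b_pos by (simp add: abs_mult)
  then show False using \<open>\<bar>of_int n * b\<bar> < a\<close> a_less_b by linarith
qed

text \<open>Points of \<open>t + b\<int>\<close> are spaced by \<open>b > a\<close>, so a cell of
  length \<open>a\<close> holds at most one of them.\<close>

lemma eq_if_floor_eq:
  assumes "\<lfloor>(t + of_int n * b) / a\<rfloor> = \<lfloor>(t + of_int n' * b) / a\<rfloor>"
  shows "n = n'"
proof -
  define m where "m = \<lfloor>(t + of_int n * b) / a\<rfloor>"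
  have "of_int m * a \<le> t + of_int n * b" "t + of_int n * b < of_int m * a + a"
    "of_int m * a \<le> t + of_int n' * b" "t + of_int n' * b < of_int m * a + a"
    using m_def assms floor_divide_eq_iff[OF a_pos] by metis+
  then have "\<bar>of_int (n - n') * b\<bar> < a" by (simp add: algebra_simps abs_less_iff)
  then show ?thesis using int_multiple_eq_0 by fastforce
qed

text \<open>\<open>y\<close> and \<open>y + jb - c\<close> share a cell of length \<open>a\<close>,
  so \<open>jb\<close> differs from \<open>c\<close> by less than \<open>a\<close>; the bounds on
  \<open>c - kb\<close> then place \<open>jb\<close> strictly between \<open>(k - 1)b\<close> and
  \<open>(k + 2)b\<close>.\<close>

lemma jump_cases:
  assumes "jump y j"
  shows "j = k \<or> j = k + 1"
proof -
  define m where "m = \<lfloor>y / a\<rfloor>"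
  have *: "of_int m * a \<le> y" "y < of_int m * a + a"
    using m_def floor_divide_eq_iff[OF a_pos] by blast+
  have **: "of_int m * a \<le> y + of_int j * b - c" "y + of_int j * b - c < of_int m * a + a"
    using m_def assms floor_divide_eq_iff[OF a_pos] unfolding jump_def by metis+
  have "of_int (k - 1) * b < of_int j * b"
    using * ** c0_gt a_less_b by (simp add: algebra_simps)
  then have "k - 1 < j" using b_pos by simp
  have "of_int j * b < of_int (k + 2) * b"
    using * ** c0_less a_less_b by (simp add: algebra_simps)
  then have "j < k + 2" using b_pos by simp
  with \<open>k - 1 < j\<close> show ?thesis by linarith
qed

lemma jump_unique:
  assumes "jump y j" "jump y j'"
  shows "j = j'"
  using eq_if_floor_eq[of "y - c" j j'] assms by (simp add: jump_def algebra_simps)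

text \<open>Distinct coset points lie in distinct cells, and a jump preserves the cell index up to
  the shift by \<open>c\<close>; hence the order of sources carries over to targets.\<close>

lemma jump_mono:
  assumes "jump (t + of_int n * b) (l - n)" "jump (t + of_int n' * b) (l' - n')" "n < n'"
  shows "l < l'"
proof -
  have floors: "\<lfloor>(t + of_int l * b - c) / a\<rfloor> = \<lfloor>(t + of_int n * b) / a\<rfloor>"
    "\<lfloor>(t + of_int l' * b - c) / a\<rfloor> = \<lfloor>(t + of_int n' * b) / a\<rfloor>"
    using assms by (simp_all add: jump_def algebra_simps)
  have "\<lfloor>(t + of_int n * b) / a\<rfloor> \<le> \<lfloor>(t + of_int n' * b) / a\<rfloor>"
    using assms(3) a_pos b_pos by (intro floor_mono divide_right_mono) auto
  then have less: "\<lfloor>(t + of_int n * b) / a\<rfloor> < \<lfloor>(t + of_int n' * b) / a\<rfloor>"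
    using eq_if_floor_eq[of t n n'] assms(3) by force
  show ?thesis
  proof (rule ccontr)
    assume "\<not> l < l'"
    then have "\<lfloor>(t + of_int l' * b - c) / a\<rfloor> \<le> \<lfloor>(t + of_int l * b - c) / a\<rfloor>"
      using a_pos b_pos by (intro floor_mono divide_right_mono) auto
    then show False using less floors by simp
  qed
qed

lemma jump_mono_iff:
  assumes "jump (t + of_int n * b) (l - n)" "jump (t + of_int n' * b) (l' - n')"
  shows "l < l' \<longleftrightarrow> n < n'"
proof
  assume "l < l'"
  moreover have "n' < n \<Longrightarrow> l' < l" using jump_mono assms by blast
  moreover have "n = n' \<Longrightarrow> l = l'"
    using assms jump_unique[of "t + of_int n * b" "l - n" "l' - n"] by simp
  ultimately show "n < n'" by (cases n n' rule: linorder_cases) auto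
qed (use assms jump_mono in blast)

section \<open>Windows and the exchange of points\<close>

definition window :: "real \<Rightarrow> int \<Rightarrow> int set" where
  "window t m = {n. of_int m * a \<le> t + of_int n * b \<and> t + of_int n * b < of_int m * a + c}"

lemma finite_window: "finite (window t m)"
proof (rule finite_subset)
  show "window t m \<subseteq> {\<lfloor>(of_int m * a - t) / b\<rfloor>..\<lceil>(of_int m * a + c - t) / b\<rceil>}"
    using b_pos by (auto simp: window_def floor_le_iff le_ceiling_iff field_simps)
qed simp

lemma c_ge_a: "a \<le> c"
proof -
  have "b \<le> of_int k * b" using k_pos b_pos by simp
  then show ?thesis using c0_gt a_less_b by linarith
qed

text \<open>Since \<open>a \<le> c\<close>, consecutive windows differ only by the points
  \<open>I\<close> that leave on the left and the points \<open>E\<close> that enter on the right.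
  Cancelling the common part \<open>C\<close> gives \<open>card I = card E\<close>.\<close>

lemma constant_count_exchange:
  assumes count: "\<And>m. card (N \<inter> window t m) = d"
  shows "(\<exists>n\<in>N. \<lfloor>(t + of_int n * b) / a\<rfloor> = m) \<longleftrightarrow> (\<exists>n\<in>N. \<lfloor>(t + of_int n * b - c) / a\<rfloor> = m)"
proof -
  define I where "I = {n\<in>N. \<lfloor>(t + of_int n * b) / a\<rfloor> = m}"
  define E where "E = {n\<in>N. \<lfloor>(t + of_int n * b - c) / a\<rfloor> = m}"
  define C where "C = N \<inter> window t m \<inter> window t (m + 1)"
  have 1: "N \<inter> window t m = I \<union> C" "I \<inter> C = {}"
    using c_ge_a a_pos
    by (auto simp: I_def C_def window_def floor_divide_eq_iff algebra_simps)
  have 2: "N \<inter> window t (m + 1) = C \<union> E" "C \<inter> E = {}"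
    using c_ge_a a_pos
    by (auto simp: E_def C_def window_def floor_divide_eq_iff algebra_simps)
  have fin: "finite I" "finite C" "finite E"
    using 1 2 finite_window by (metis finite_Int finite_Un)+
  have "card I + card C = card C + card E"
    using count[of m] count[of "m + 1"] 1 2 fin by (simp add: card_Un_disjoint)
  then have "I = {} \<longleftrightarrow> E = {}" using fin by auto
  then show ?thesis unfolding I_def E_def by blast
qed

section \<open>Finite approximations and the core\<close>

primrec approx :: "nat \<Rightarrow> real set" where
  "approx 0 = UNIV"
| "approx (Suc N) = {y \<in> approx N.
     (\<exists>j\<in>{k, k + 1}. jump y j \<and> y + of_int j * b \<in> approx N) \<and>
     (\<exists>j\<in>{k, k + 1}. jump (y - of_int j * b) j \<and> y - of_int j * b \<in> approx N)}"

text \<open>The bounded choice in \<open>approx\<close> keeps each level a finite combination of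
  jump domains; \<open>jump_cases\<close> lets proofs ignore the bound.\<close>

lemma approx_Suc_iff:
  "y \<in> approx (Suc N) \<longleftrightarrow> y \<in> approx N \<and> (\<exists>j. jump y j \<and> y + of_int j * b \<in> approx N) \<and>
     (\<exists>j. jump (y - of_int j * b) j \<and> y - of_int j * b \<in> approx N)"
  using jump_cases by (simp only: approx.simps mem_Collect_eq) blast

text \<open>The set \<open>core\<close> turns out to consist of the points on bi-infinite orbits of \<open>jump\<close>.\<close>

definition core :: "real set" where
  "core = (\<Inter>N. approx N)"

definition biclosed :: "real \<Rightarrow> int set \<Rightarrow> bool" where
  "biclosed t N \<longleftrightarrow> (\<forall>n\<in>N. (\<exists>n'\<in>N. jump (t + of_int n * b) (n' - n)) \<and>
     (\<exists>n'\<in>N. jump (t + of_int n' * b) (n - n')))"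

lemma constant_count_biclosed:
  assumes count: "\<And>m. card (N \<inter> window t m) = d"
  shows "biclosed t N"
  unfolding biclosed_def
proof (intro ballI conjI)
  fix n assume n: "n \<in> N"
  have jump_iff: "jump (t + of_int n * b) (n' - n) \<longleftrightarrow>
      \<lfloor>(t + of_int n' * b - c) / a\<rfloor> = \<lfloor>(t + of_int n * b) / a\<rfloor>" for n n'
    by (simp add: jump_def algebra_simps)
  show "\<exists>n'\<in>N. jump (t + of_int n * b) (n' - n)"
    using n constant_count_exchange[OF count, of "\<lfloor>(t + of_int n * b) / a\<rfloor>"]
    unfolding jump_iff by blast
  \<comment> \<open>The predecessor comes from the cell of \<open>y - c\<close> instead of the cell
    of \<open>y\<close>.\<close>
  show "\<exists>n'\<in>N. jump (t + of_int n' * b) (n - n')"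
    using n constant_count_exchange[OF count, of "\<lfloor>(t + of_int n * b - c) / a\<rfloor>"]
    unfolding jump_iff by metis
qed

lemma biclosed_subset_core:
  assumes "biclosed t N" "n \<in> N"
  shows "t + of_int n * b \<in> core"
proof -
  have "\<forall>n\<in>N. t + of_int n * b \<in> approx M" for M
  proof (induction M)
    case (Suc M)
    show ?case
    proof
      fix n assume n: "n \<in> N"
      obtain n1 n2 where n12: "n1 \<in> N" "n2 \<in> N" "jump (t + of_int n * b) (n1 - n)"
        "jump (t + of_int n2 * b) (n - n2)"
        using assms(1) n unfolding biclosed_def by blast
      have e: "t + of_int n * b + of_int (n1 - n) * b = t + of_int n1 * b"
        "t + of_int n * b - of_int (n - n2) * b = t + of_int n2 * b"
        by (simp_all add: algebra_simps)
      have "jump (t + of_int n * b) (n1 - n) \<and> t + of_int n * b + of_int (n1 - n) * b \<in> approx M"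
        "jump (t + of_int n * b - of_int (n - n2) * b) (n - n2) \<and>
          t + of_int n * b - of_int (n - n2) * b \<in> approx M"
        unfolding e using Suc n12 by auto
      then show "t + of_int n * b \<in> approx (Suc M)"
        unfolding approx_Suc_iff using Suc n by blast
    qed
  qed simp
  then show ?thesis using assms(2) by (simp add: core_def)
qed

lemma approx_Suc_subset: "approx (Suc N) \<subseteq> approx N" by (rule subsetI) (simp only: approx_Suc_iff)

declare approx.simps(2) [simp del]

text \<open>At every level one of the two jump lengths works. By pigeonhole a single length works at
  all levels, so successor and predecessor stay in the intersection.\<close>

lemma biclosed_core: "biclosed t {n. t + of_int n * b \<in> core}"
proof -
  have 1: "\<exists>j. jump y j \<and> y + of_int j * b \<in> core" if "y \<in> core" for y
  proof -
    have "\<exists>j\<in>{k, k + 1}. \<forall>N. jump y j \<and> y + of_int j * b \<in> approx N"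
    proof (rule decseq_finite_choice)
      show "\<exists>j\<in>{k, k + 1}. jump y j \<and> y + of_int j * b \<in> approx N" for N
      proof -
        have "y \<in> approx (Suc N)" using that unfolding core_def by blast
        then show ?thesis by (simp only: approx.simps mem_Collect_eq)
      qed
    qed (use approx_Suc_subset in blast)+
    then show ?thesis unfolding core_def by blast
  qed
  have 2: "\<exists>j. jump (y - of_int j * b) j \<and> y - of_int j * b \<in> core" if "y \<in> core" for y
  proof -
    have "\<exists>j\<in>{k, k + 1}. \<forall>N. jump (y - of_int j * b) j \<and> y - of_int j * b \<in> approx N"
    proof (rule decseq_finite_choice)
      show "\<exists>j\<in>{k, k + 1}. jump (y - of_int j * b) j \<and> y - of_int j * b \<in> approx N" for N
      proof -
        have "y \<in> approx (Suc N)" using that unfolding core_def by blast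
        then show ?thesis by (simp only: approx.simps mem_Collect_eq)
      qed
    qed (use approx_Suc_subset in blast)+
    then show ?thesis unfolding core_def by blast
  qed
  show ?thesis unfolding biclosed_def
  proof (intro ballI conjI)
    fix n assume "n \<in> {n. t + of_int n * b \<in> core}"
    then have n: "t + of_int n * b \<in> core" by simp
    obtain j where "jump (t + of_int n * b) j" "t + of_int n * b + of_int j * b \<in> core"
      using 1[OF n] by blast
    then show "\<exists>n'\<in>{n. t + of_int n * b \<in> core}. jump (t + of_int n * b) (n' - n)"
      by (intro bexI[of _ "n + j"]) (auto simp: algebra_simps)
    obtain j where "jump (t + of_int n * b - of_int j * b) j" "t + of_int n * b - of_int j * b \<in> core"
      using 2[OF n] by blast
    then show "\<exists>n'\<in>{n. t + of_int n * b \<in> core}. jump (t + of_int n' * b) (n - n')"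
      by (intro bexI[of _ "n - j"]) (auto simp: algebra_simps)
  qed
qed

section \<open>Bi-infinite orbits\<close>

definition orbit :: "real \<Rightarrow> (int \<Rightarrow> int) \<Rightarrow> bool" where
  "orbit t z \<longleftrightarrow> (\<forall>i. jump (t + of_int (z i) * b) (z (i + 1) - z i))"

lemma biclosed_orbit:
  assumes "biclosed t N" "n \<in> N"
  obtains z where "orbit t z" "z 0 = n" "range z \<subseteq> N"
proof -
  have fwd: "\<exists>n'\<in>N. jump (t + of_int n * b) (n' - n)" if "n \<in> N" for n
    using assms(1) that unfolding biclosed_def by blast
  have bwd: "\<exists>n'\<in>N. jump (t + of_int n' * b) (n - n')" if "n \<in> N" for n
    using assms(1) that unfolding biclosed_def by blast
  show ?thesis
    using int_orbit_exists[of n N "\<lambda>n n'. jump (t + of_int n * b) (n' - n)", OF assms(2) fwd bwd] that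
    unfolding orbit_def by blast
qed

lemma orbit_less: "orbit t z \<Longrightarrow> z i < z (i + 1)"
  using jump_cases[of _ "z (i + 1) - z i"] k_pos unfolding orbit_def by force

lemma orbit_brackets:
  assumes "orbit t z"
  obtains i where "z i \<le> r" "r < z (i + 1)"
  by (rule int_increasing_sequence_brackets[of z r, OF orbit_less[OF assms]])

text \<open>Let \<open>z i\<close> be the last orbit point left of the window. Its cell is below
  \<open>m\<close>, so the next point lies left of \<open>ma + c\<close>; the cell of that next
  point is at least \<open>m\<close>, so the one after it is already past the window.\<close>

lemma orbit_one_per_window:
  assumes "orbit t z"
  shows "card (range z \<inter> window t m) = 1"
proof -
  have mono: "strict_mono z" by (rule strict_mono_int_if_step) (rule orbit_less[OF assms])
  \<comment> \<open>The largest index whose point lies strictly left of the window.\<close>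
  define r where "r = \<lceil>(of_int m * a - t) / b\<rceil> - 1"
  have r: "n \<le> r \<longleftrightarrow> t + of_int n * b < of_int m * a" for n
  proof -
    have "n \<le> r \<longleftrightarrow> n < \<lceil>(of_int m * a - t) / b\<rceil>" by (simp add: r_def)
    also have "\<dots> \<longleftrightarrow> t + of_int n * b < of_int m * a"
      using b_pos by (simp add: less_ceiling_iff field_simps)
    finally show ?thesis .
  qed
  obtain i where i: "z i \<le> r" "r < z (i + 1)" using orbit_brackets[OF assms] .
  have fl: "\<lfloor>(t + of_int (z (j + 1)) * b - c) / a\<rfloor> = \<lfloor>(t + of_int (z j) * b) / a\<rfloor>" for j
    using assms unfolding orbit_def jump_def by (simp add: left_diff_distrib)
  have "\<lfloor>(t + of_int (z i) * b) / a\<rfloor> < m"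
    using i(1) r a_pos by (simp add: floor_less_iff field_simps)
  then have "\<lfloor>(t + of_int (z (i + 1)) * b - c) / a\<rfloor> < m" using fl by simp
  then have A: "t + of_int (z (i + 1)) * b < of_int m * a + c"
    using a_pos by (simp add: floor_less_iff field_simps)
  have B: "of_int m * a \<le> t + of_int (z (i + 1)) * b" using i(2) r[of "z (i + 1)"] by linarith
  then have "m \<le> \<lfloor>(t + of_int (z (i + 1)) * b) / a\<rfloor>" using a_pos by (simp add: le_floor_iff field_simps)
  then have "m \<le> \<lfloor>(t + of_int (z (i + 1 + 1)) * b - c) / a\<rfloor>" unfolding fl .
  then have C: "of_int m * a + c \<le> t + of_int (z (i + 1 + 1)) * b"
    using a_pos by (simp add: le_floor_iff field_simps)
  have "range z \<inter> window t m = {z (i + 1)}"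
  proof (intro equalityI subsetI)
    fix n assume "n \<in> range z \<inter> window t m"
    then obtain j where j: "n = z j" "of_int m * a \<le> t + of_int n * b" "t + of_int n * b < of_int m * a + c"
      by (auto simp: window_def)
    have "z i < z j" using j r[of "z j"] i by simp
    then have "i < j" using mono strict_mono_less by blast
    have "real_of_int (z j) * b < of_int (z (i + 1 + 1)) * b" using j(3) C unfolding j(1) by linarith
    then have "z j < z (i + 1 + 1)" using b_pos by simp
    then have "j < i + 1 + 1" using mono strict_mono_less by blast
    with \<open>i < j\<close> have "j = i + 1" by simp
    then show "n \<in> {z (i + 1)}" using j by simp
  qed (use A B in \<open>auto simp: window_def\<close>)
  then show ?thesis by simp
qed

text \<open>\<open>jump_mono_iff\<close> is an equivalence, so the order relations at index 0
  propagate both forward and backward.\<close>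

lemma orbits_interlace:
  assumes z: "orbit t z" and w: "orbit t w" and "z 0 < w 0" "w 0 < z 1"
  shows "z i < w i \<and> w i < z (i + 1)"
proof (induction i rule: int_induct[where k = 0])
  case base
  show ?case using assms by simp
next
  have step: "z (i + 1) < w (i + 1) \<longleftrightarrow> z i < w i" "w (i + 1) < z (i + 1 + 1) \<longleftrightarrow> w i < z (i + 1)" for i
    using z w jump_mono_iff unfolding orbit_def by blast+
  {
    case (step1 i)
    then show ?case using step by blast
  next
    case (step2 i)
    then show ?case using step[of "i - 1"] by simp
  }
qed

lemma orbits_disjoint:
  assumes z: "orbit t z" and w: "orbit t w" and "z 0 < w 0" "w 0 < z 1"
  shows "range z \<inter> range w = {}"
proof -
  have mono: "strict_mono z" by (rule strict_mono_int_if_step) (rule orbit_less[OF z])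
  have "z i \<noteq> w j" for i j
  proof
    assume "z i = w j"
    then have "z j < z i" "z i < z (j + 1)" using orbits_interlace[OF assms, of j] by auto
    then have "j < i" "i < j + 1" using mono strict_mono_less by blast+
    then show False by simp
  qed
  then show ?thesis by auto
qed

section \<open>From matrix equations to counts and orbits\<close>

lemma Mapply_eq_card:
  assumes "\<And>n. x n = 0 \<or> x n = 1"
  shows "Mapply a b c t x m = of_nat (card ({n. x n = 1} \<inter> window t m))"
proof -
  have eq: "{n. Mmat a b c t m n \<noteq> 0} = window t m"
    by (auto simp: Mmat_def window_def indicator_def)
  have "Mapply a b c t x m = (\<Sum>n\<in>window t m. if n \<in> {n. x n = 1} then 1 else 0)"
    unfolding Mapply_def eq
    by (rule sum.cong) (use assms in \<open>auto simp: Mmat_def window_def indicator_def\<close>)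
  also have "\<dots> = of_nat (card ({n. x n = 1} \<inter> window t m))"
    by (subst sum.inter_restrict[symmetric]) (simp_all add: finite_window Int_commute)
  finally show ?thesis .
qed

lemma in_set_iff_constant_count:
  "(\<exists>x\<in>B0. \<forall>m. Mapply a b c t x m = of_nat d) \<longleftrightarrow>
   (\<exists>N. 0 \<in> N \<and> (\<forall>m. card (N \<inter> window t m) = d))"
proof
  assume "\<exists>x\<in>B0. \<forall>m. Mapply a b c t x m = of_nat d"
  then obtain x where x: "x \<in> B0" "\<And>m. Mapply a b c t x m = of_nat d" by blast
  then have "card ({n. x n = 1} \<inter> window t m) = d" for m
    using Mapply_eq_card[of x t m] by (simp add: B0_def)
  then show "\<exists>N. 0 \<in> N \<and> (\<forall>m. card (N \<inter> window t m) = d)"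
    using x by (intro exI[of _ "{n. x n = 1}"]) (auto simp: B0_def)
next
  assume "\<exists>N. 0 \<in> N \<and> (\<forall>m. card (N \<inter> window t m) = d)"
  then obtain N where N: "0 \<in> N" "\<And>m. card (N \<inter> window t m) = d" by blast
  define x :: "int \<Rightarrow> real" where "x n = (if n \<in> N then 1 else 0)" for n
  have "{n. x n = 1} = N" by (auto simp: x_def)
  then have "Mapply a b c t x m = of_nat d" for m
    using Mapply_eq_card[of x t m] N by (simp add: x_def)
  moreover have "x \<in> B0" using N by (auto simp: B0_def x_def)
  ultimately show "\<exists>x\<in>B0. \<forall>m. Mapply a b c t x m = of_nat d" by blast
qed

lemma Sset_iff: "t \<in> Sset a b c \<longleftrightarrow> (\<exists>N. 0 \<in> N \<and> (\<forall>m. card (N \<inter> window t m) = 1))"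
  using in_set_iff_constant_count[of t 1] by (simp add: Sset_def)

lemma Dset_iff: "t \<in> Dset a b c \<longleftrightarrow> (\<exists>N. 0 \<in> N \<and> (\<forall>m. card (N \<inter> window t m) = 2))"
  using in_set_iff_constant_count[of t 2] by (simp add: Dset_def)

text \<open>A set counted once per window is biclosed, hence in \<open>core\<close>; conversely, the
  orbit through a core point is counted once per window.\<close>

lemma Sset_eq_core: "Sset a b c = core"
proof (intro equalityI subsetI)
  fix t assume "t \<in> Sset a b c"
  then obtain N where "0 \<in> N" "\<And>m. card (N \<inter> window t m) = 1" using Sset_iff by blast
  then show "t \<in> core" using biclosed_subset_core[OF constant_count_biclosed, of N t 1 0] by simp
next
  fix t assume "t \<in> core"
  then have "0 \<in> {n. t + of_int n * b \<in> core}" by simp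
  then obtain z where "orbit t z" "z 0 = 0" using biclosed_orbit[OF biclosed_core] by blast
  moreover from this have "0 \<in> range z" by (metis rangeI)
  ultimately show "t \<in> Sset a b c" unfolding Sset_iff using orbit_one_per_window by blast
qed

text \<open>A companion \<open>s + jb\<close> strictly between \<open>s\<close> and its successor
  generates a second orbit that interlaces with the first. The two are disjoint and together meet
  each window twice.\<close>

lemma Dset_eq:
  "Dset a b c = {s \<in> core. \<exists>j\<in>{1..k}. \<exists>j'\<in>{k, k + 1}. jump s j' \<and> j < j' \<and> s + of_int j * b \<in> core}"
  (is "_ = ?D")
proof (intro equalityI subsetI)
  fix t assume "t \<in> Dset a b c"
  then obtain N where N: "0 \<in> N" "\<And>m. card (N \<inter> window t m) = 2" using Dset_iff by blast
  then have bi: "biclosed t N" using constant_count_biclosed by blast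
  then obtain l where l: "l \<in> N" "jump t l"
    using N(1) unfolding biclosed_def by fastforce
  define m where "m = \<lfloor>t / a\<rfloor>"
  have m: "of_int m * a \<le> t" "t < of_int m * a + a"
    using m_def floor_divide_eq_iff[OF a_pos] by blast+
  have "of_int m * a \<le> t + of_int l * b - c"
    using m_def l(2) floor_divide_eq_iff[OF a_pos] unfolding jump_def by metis
  \<comment> \<open>The window starting at the cell of \<open>t\<close> contains \<open>t\<close>
    and exactly one other point \<open>j\<close>.\<close>
  have "0 \<in> N \<inter> window t m" using N(1) m c_ge_a by (auto simp: window_def)
  moreover have "\<not> N \<inter> window t m \<subseteq> {0}" 
    using N(2)[of m] card_mono[of "{0}" "N \<inter> window t m"] by auto
  ultimately obtain j where j: "j \<in> N" "j \<in> window t m" "j \<noteq> 0" by blast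
  have jw: "of_int m * a \<le> t + of_int j * b" "t + of_int j * b < of_int m * a + c"
    using j by (auto simp: window_def)
  \<comment> \<open>The successor \<open>l\<close> lies at or beyond the right end of this window,
    while \<open>j\<close> is inside it.\<close>
  have "of_int j * b < of_int l * b" using jw \<open>of_int m * a \<le> t + of_int l * b - c\<close> by linarith
  then have "j < l" using b_pos by simp
  \<comment> \<open>Window points lie less than \<open>a < b\<close> to the left of
    \<open>t\<close>, which excludes negative \<open>j\<close>.\<close>
  have "- b < of_int j * b" using jw m a_less_b by linarith
  then have "of_int (-1) * b < of_int j * b" by simp
  then have "-1 < j" using b_pos mult_less_cancel_right_pos of_int_less_iff by blast
  then have "j \<ge> 1" using j by simp
  have lk: "l = k \<or> l = k + 1" using jump_cases l by blast
  have "t \<in> core" using biclosed_subset_core[OF bi N(1)] by simp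
  moreover have "t + of_int j * b \<in> core" using biclosed_subset_core[OF bi j(1)] .
  moreover have "j \<in> {1..k}" "l \<in> {k, k + 1}" using lk \<open>j < l\<close> \<open>j \<ge> 1\<close> by auto
  ultimately show "t \<in> ?D" using l \<open>j < l\<close> by blast
next
  fix t assume "t \<in> ?D"
  then obtain j j' where j: "t \<in> core" "j \<in> {1..k}" "j < j'" "jump t j'" "t + of_int j * b \<in> core"
    by blast
  obtain z where z: "orbit t z" "z 0 = 0"
    by (rule biclosed_orbit[OF biclosed_core[of t], of 0]) (use j(1) in auto)
  obtain w where w: "orbit t w" "w 0 = j"
    by (rule biclosed_orbit[OF biclosed_core[of t], of j]) (use j(5) in auto)
  have "jump (t + of_int (z 0) * b) (z (0 + 1) - z 0)" using z(1) unfolding orbit_def by blast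
  then have "z 1 = j'" using z(2) j(4) jump_unique by simp
  then have disj: "range z \<inter> range w = {}"
    using orbits_disjoint[OF z(1) w(1)] z w j by simp
  have "card ((range z \<union> range w) \<inter> window t m) = 2" for m
  proof -
    have "card (range z \<inter> window t m \<union> range w \<inter> window t m)
        = card (range z \<inter> window t m) + card (range w \<inter> window t m)"
      by (rule card_Un_disjoint) (use disj finite_window in auto)
    then show ?thesis
      using orbit_one_per_window[OF z(1), of m] orbit_one_per_window[OF w(1), of m]
      by (simp add: Int_Un_distrib2)
  qed
  moreover have "0 \<in> range z \<union> range w" using z(2) by (metis UnI1 rangeI)
  ultimately show "t \<in> Dset a b c"
    unfolding Dset_iff by (intro exI[of _ "range z \<union> range w"] conjI allI)
qed

section \<open>Cylinder sets\<close>

text \<open>Generating the class from jump domains lets periodicity, measurability, local constancy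
  to the right and grid invariance each be proved by one induction.\<close>

inductive cylinder :: "real set \<Rightarrow> bool" where
  jump: "cylinder {y. jump y j}"
| Un: "cylinder V \<Longrightarrow> cylinder W \<Longrightarrow> cylinder (V \<union> W)"
| Compl: "cylinder V \<Longrightarrow> cylinder (- V)"
| shift: "cylinder V \<Longrightarrow> cylinder {x. x + of_int n * b \<in> V}" for n :: int

lemma cylinder_UNIV: "cylinder UNIV"
  using Un[OF jump[of 0] Compl[OF jump[of 0]]] by (simp only: Compl_partition)

lemma cylinder_Int: "cylinder V \<Longrightarrow> cylinder W \<Longrightarrow> cylinder (V \<inter> W)"
  using Compl[OF Un[OF Compl[of V] Compl[of W]]] by (simp only: Compl_Un double_complement)

lemma cylinder_UNION:
  assumes "finite J" "\<And>j. j \<in> J \<Longrightarrow> cylinder (V j)"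
  shows "cylinder (\<Union>j\<in>J. V j)"
  using assms
proof (induction J)
  case empty
  show ?case using Compl[OF cylinder_UNIV] by simp
next
  case (insert j J)
  then have "cylinder (V j \<union> (\<Union>j\<in>J. V j))" by (intro Un) auto
  then show ?case by simp
qed

lemma cylinder_periodic: "cylinder V \<Longrightarrow> x + a \<in> V \<longleftrightarrow> x \<in> V"
proof (induction arbitrary: x rule: cylinder.induct)
  case (jump j)
  have "(x + a + of_int j * b - c) / a = (x + of_int j * b - c) / a + 1" "(x + a) / a = x / a + 1"
    using a_pos by (simp_all add: field_simps)
  then show ?case by (simp add: jump_def)
next
  case (shift n V)
  then show ?case using shift.IH[of "x + of_int n * b"] by (simp add: algebra_simps)
qed auto

lemma cylinder_borel: "cylinder V \<Longrightarrow> V \<in> sets borel"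
proof (induction rule: cylinder.induct)
  case (jump j)
  have "{y \<in> space borel. \<lfloor>(y + of_int j * b - c) / a\<rfloor> = \<lfloor>y / a\<rfloor>} \<in> sets borel" by measurable
  then show ?case by (simp add: jump_def)
next
  case (Un V W)
  from Un.IH show ?case by (rule sets.Un)
next
  case (Compl V)
  from Compl.IH show ?case by (rule borel_comp)
next
  case (shift n V)
  have "(\<lambda>x. x + of_int n * b) -` V \<inter> space borel \<in> sets borel"
    by (rule measurable_sets[OF _ shift.IH]) simp
  then show ?case by (simp add: vimage_def)
qed

lemma cylinder_right_constant:
  "cylinder V \<Longrightarrow> \<exists>e>0. \<forall>y. x \<le> y \<and> y < x + e \<longrightarrow> (y \<in> V \<longleftrightarrow> x \<in> V)"
proof (induction arbitrary: x rule: cylinder.induct)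
  case (jump j)
  obtain e1 where e1: "e1 > 0" "\<And>y. x \<le> y \<Longrightarrow> y < x + e1 \<Longrightarrow> \<lfloor>(y + (of_int j * b - c)) / a\<rfloor> = \<lfloor>(x + (of_int j * b - c)) / a\<rfloor>"
    using floor_divide_eventually_right_constant[OF a_pos] by meson
  obtain e2 where e2: "e2 > 0" "\<And>y. x \<le> y \<Longrightarrow> y < x + e2 \<Longrightarrow> \<lfloor>(y + 0) / a\<rfloor> = \<lfloor>(x + 0) / a\<rfloor>"
    using floor_divide_eventually_right_constant[OF a_pos] by meson
  have "jump y j \<longleftrightarrow> jump x j" if "x \<le> y" "y < x + min e1 e2" for y
    using e1(2)[of y] e2(2)[of y] that by (simp add: jump_def add_diff_eq)
  moreover have "0 < min e1 e2" using e1(1) e2(1) by simp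
  ultimately show ?case by blast
next
  case (Un V W)
  obtain e1 where e1: "e1 > 0" "\<And>y. x \<le> y \<Longrightarrow> y < x + e1 \<Longrightarrow> (y \<in> V \<longleftrightarrow> x \<in> V)" using Un.IH(1) by meson
  obtain e2 where e2: "e2 > 0" "\<And>y. x \<le> y \<Longrightarrow> y < x + e2 \<Longrightarrow> (y \<in> W \<longleftrightarrow> x \<in> W)" using Un.IH(2) by meson
  have "y \<in> V \<union> W \<longleftrightarrow> x \<in> V \<union> W" if "x \<le> y" "y < x + min e1 e2" for y
    using e1(2)[of y] e2(2)[of y] that by simp
  moreover have "0 < min e1 e2" using e1(1) e2(1) by simp
  ultimately show ?case by blast
next
  case (Compl V)
  then show ?case by simp
next
  case (shift n V)
  obtain e where e: "e > 0" "\<And>y. x + of_int n * b \<le> y \<Longrightarrow> y < x + of_int n * b + e \<Longrightarrow> (y \<in> V \<longleftrightarrow> x + of_int n * b \<in> V)"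
    using shift.IH by meson
  have "y + of_int n * b \<in> V \<longleftrightarrow> x + of_int n * b \<in> V" if "x \<le> y" "y < x + e" for y
    using e(2)[of "y + of_int n * b"] that by simp
  then show ?case using e(1) by blast
qed

text \<open>When \<open>a\<close>, \<open>b\<close> and \<open>c\<close> are multiples of
  \<open>g\<close>, every floor in \<open>jump\<close> depends only on the grid index: dividing by
  \<open>a\<close> is integer division of that index by \<open>p\<close>.\<close>

lemma cylinder_grid:
  fixes p q z :: int
  assumes "0 < g" "0 < p" "a = of_int p * g" "b = of_int q * g" "c = of_int z * g"
  shows "cylinder V \<Longrightarrow> \<lfloor>x / g\<rfloor> = \<lfloor>y / g\<rfloor> \<Longrightarrow> x \<in> V \<longleftrightarrow> y \<in> V"
proof (induction arbitrary: x y rule: cylinder.induct)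
  case (jump j)
  have 1: "\<lfloor>(x + of_int n * g) / a\<rfloor> = (\<lfloor>x / g\<rfloor> + n) div p" for x and n :: int
  proof -
    have "(x + of_int n * g) / a = (x / g + of_int n) / of_int p"
      using assms(1,2) unfolding assms(3) by (simp add: field_simps)
    then show ?thesis using assms(2) by (simp add: floor_divide_real_eq_div)
  qed
  have "\<lfloor>(x + of_int j * b - c) / a\<rfloor> = (\<lfloor>x / g\<rfloor> + (j * q - z)) div p" for x
    using 1[of x "j * q - z"] unfolding assms(4,5) by (simp add: algebra_simps)
  moreover have "\<lfloor>x / a\<rfloor> = \<lfloor>x / g\<rfloor> div p" for x using 1[of x 0] by simp
  ultimately show ?case using jump by (simp add: jump_def)
next
  case (shift n V)
  have "\<lfloor>(x + of_int n * b) / g\<rfloor> = \<lfloor>x / g\<rfloor> + n * q" for x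
  proof -
    have "(x + of_int n * b) / g = x / g + of_int (n * q)"
      using assms(1) unfolding assms(4) by (simp add: field_simps)
    then show ?thesis by (metis floor_add_int)
  qed
  then show ?case
    using shift.IH[of "x + of_int n * b" "y + of_int n * b"] shift.prems by simp
next
  case (Un V W)
  then show ?case by blast
next
  case (Compl V)
  then show ?case by blast
qed

section \<open>Cylinders containing a coset, and covers by towers\<close>

definition commensurable_or_irrational :: bool where
  "commensurable_or_irrational \<longleftrightarrow> a / b \<notin> \<rat> \<or>
     (\<exists>p q :: int. p > 0 \<and> q > 0 \<and> coprime p q \<and> a / b = of_int p / of_int q
        \<and> (\<exists>z :: int. c / b = of_int z / of_int q))"

text \<open>By periodicity \<open>V\<close> contains all of \<open>t + a\<int> + b\<int>\<close>.
  This set is dense in the irrational case and meets every grid cell in the commensurable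
  one.\<close>

lemma cylinder_eq_UNIV:
  assumes "commensurable_or_irrational" "cylinder V" and V: "\<And>n :: int. t + of_int n * b \<in> V"
  shows "V = UNIV"
proof -
  have mem: "t + of_int n * b + of_int m * a \<in> V" for n m
    using V periodic_int_multiple[of a V] cylinder_periodic[OF assms(2)] by blast
  have "x \<in> V" for x
    using assms(1) unfolding commensurable_or_irrational_def
  proof (elim disjE exE conjE)
    assume irr: "a / b \<notin> \<rat>"
    have "b / a \<notin> \<rat>"
    proof
      assume "b / a \<in> \<rat>"
      then have "inverse (b / a) \<in> \<rat>" by (rule Rats_inverse)
      then show False using irr by simp
    qed
    obtain e where e: "e > 0" "\<And>y. x \<le> y \<Longrightarrow> y < x + e \<Longrightarrow> (y \<in> V \<longleftrightarrow> x \<in> V)"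
      using cylinder_right_constant[OF assms(2)] by meson
    \<comment> \<open>Density is aimed at the midpoint of \<open>[x, x + e)\<close>, where
      membership agrees with that of \<open>x\<close>.\<close>
    have "0 < e / 2 / a" using e(1) a_pos by simp
    then obtain h n where hn: "\<bar>of_int n * (b / a) - of_int h - (x + e / 2 - t) / a\<bar> < e / 2 / a"
      using sequence_of_fractional_parts_is_dense[OF \<open>b / a \<notin> \<rat>\<close>] by meson
    define y where "y = t + of_int n * b + of_int (- h) * a"
    have "of_int n * (b / a) - of_int h - (x + e / 2 - t) / a = (y - (x + e / 2)) / a"
      using a_pos by (simp add: y_def field_simps)
    then have "\<bar>y - (x + e / 2)\<bar> < e / 2"
      using hn a_pos by (simp only: abs_divide abs_of_pos divide_less_cancel if_True)
    then have "x \<le> y" "y < x + e" unfolding abs_less_iff by linarith+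
    then show "x \<in> V" using e(2) mem y_def by blast
  next
    fix p q z :: int
    assume pq: "0 < p" "0 < q" "coprime p q" "a / b = of_int p / of_int q" "c / b = of_int z / of_int q"
    define g where "g = b / of_int q"
    have g: "0 < g" "a = of_int p * g" "b = of_int q * g" "c = of_int z * g"
      using pq b_pos by (auto simp: g_def field_simps)
    define d where "d = \<lfloor>x / g\<rfloor> - \<lfloor>t / g\<rfloor>"
    \<comment> \<open>Bezout turns a step by \<open>d\<close> grid cells into an integer combination
      of \<open>a\<close> and \<open>b\<close>.\<close>
    obtain u v where uv: "u * p + v * q = 1" using pq(3) bezout_int[of p q] by auto
    define y where "y = t + of_int (d * v) * b + of_int (d * u) * a"
    have "y = t + of_int (d * (u * p + v * q)) * g"
      unfolding y_def g(2,3) by (simp add: algebra_simps)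
    then have "y / g = t / g + of_int d" unfolding uv using g(1) by (simp add: field_simps)
    then have "\<lfloor>y / g\<rfloor> = \<lfloor>t / g\<rfloor> + d" by (metis floor_add_int)
    then have "\<lfloor>y / g\<rfloor> = \<lfloor>x / g\<rfloor>" by (simp add: d_def)
    then show "x \<in> V"
      using cylinder_grid[OF g(1) pq(1) g(2-4) assms(2)] mem y_def by blast
  qed
  then show ?thesis by blast
qed

lemma cylinder_shift_minus: "cylinder V \<Longrightarrow> cylinder {x. x - of_int n * b \<in> V}" for n :: int
  using shift[of V "- n"] by simp

lemma cylinder_approx: "cylinder (approx N)"
proof (induction N)
  case (Suc N)
  have "approx (Suc N) = approx N \<inter>
     (\<Union>j\<in>{k, k + 1}. {y. jump y j} \<inter> {y. y + of_int j * b \<in> approx N}) \<inter>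
     (\<Union>j\<in>{k, k + 1}. {y. y - of_int j * b \<in> {y. jump y j}} \<inter> {y. y - of_int j * b \<in> approx N})"
    unfolding approx.simps by blast
  also have "cylinder \<dots>"
    by (intro cylinder_Int cylinder_UNION Suc jump shift cylinder_shift_minus) auto
  finally show ?case .
qed (simp add: cylinder_UNIV)

text \<open>The number of \<open>j \<in> {0..k}\<close> with \<open>x \<in> tower core j\<close> is the number of orbits in
  \<open>x + b\<int>\<close>, since each orbit has exactly one point \<open>y \<le> x\<close> whose jump passes \<open>x\<close>.\<close>

definition tower :: "real set \<Rightarrow> int \<Rightarrow> real set" where
  "tower T j = {x. x - of_int j * b \<in> T \<and> (\<exists>l\<in>{k, k + 1}. jump (x - of_int j * b) l \<and> j < l)}"

lemma cylinder_tower: "cylinder T \<Longrightarrow> cylinder (tower T j)"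
proof -
  assume T: "cylinder T"
  have "tower T j = {x. x - of_int j * b \<in> T} \<inter>
     (\<Union>l\<in>{l \<in> {k, k + 1}. j < l}. {x. x - of_int j * b \<in> {y. jump y l}})"
    by (auto simp: tower_def)
  also have "cylinder \<dots>"
    by (intro cylinder_Int cylinder_UNION T jump cylinder_shift_minus) auto
  finally show ?thesis .
qed

text \<open>At each finite level the union of towers is a cylinder, and one orbit suffices to put a
  whole coset into it, so it is the line; pigeonhole over the floors passes to the intersection.
  \<open>T\<close> is kept general to serve both \<open>core\<close> and
  \<open>Dset\<close>.\<close>

lemma towers_cover:
  assumes ci: commensurable_or_irrational
    and cyl: "\<And>N :: nat. cylinder (T N)" and dec: "\<And>N. T (Suc N) \<subseteq> T N"
    and bi: "biclosed t G" "n0 \<in> G" and G: "\<And>n. n \<in> G \<Longrightarrow> t + of_int n * b \<in> (\<Inter>N. T N)"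
  shows "(\<Union>j\<in>{0..k}. tower (\<Inter>N. T N) j) = UNIV"
proof -
  have full: "(\<Union>j\<in>{0..k}. tower (T N) j) = UNIV" for N
  proof (rule cylinder_eq_UNIV[OF ci])
    show "cylinder (\<Union>j\<in>{0..k}. tower (T N) j)"
      by (intro cylinder_UNION cylinder_tower cyl) auto
    obtain z where z: "orbit t z" "range z \<subseteq> G" using biclosed_orbit[OF bi] by blast
    show "t + of_int n * b \<in> (\<Union>j\<in>{0..k}. tower (T N) j)" for n
    proof -
      \<comment> \<open>The jump starting at \<open>z i\<close> passes over \<open>n\<close>, so the
        floor of the tower is the offset \<open>n - z i\<close>.\<close>
      obtain i where i: "z i \<le> n" "n < z (i + 1)" by (rule orbit_brackets[OF z(1)])
      have j: "jump (t + of_int (z i) * b) (z (i + 1) - z i)" using z(1) by (simp add: orbit_def)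
      have l: "z (i + 1) - z i = k \<or> z (i + 1) - z i = k + 1" using jump_cases[OF j] .
      have e: "t + of_int n * b - of_int (n - z i) * b = t + of_int (z i) * b"
        by (simp add: algebra_simps)
      have "t + of_int (z i) * b \<in> T N" using G z(2) by blast
      moreover have "z (i + 1) - z i \<in> {k, k + 1}" "n - z i < z (i + 1) - z i" using i l by auto
      ultimately have "t + of_int n * b \<in> tower (T N) (n - z i)"
        unfolding tower_def mem_Collect_eq e using j by blast
      moreover have "n - z i \<in> {0..k}" using i l by auto
      ultimately show ?thesis by blast
    qed
  qed
  have "\<exists>j\<in>{0..k}. \<forall>N. x \<in> tower (T N) j" for x
  proof (rule decseq_finite_choice)
    show "\<exists>j\<in>{0..k}. x \<in> tower (T N) j" for N using full[of N] by blast
  qed (use dec in \<open>auto simp: tower_def\<close>)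
  then show ?thesis by (auto simp: tower_def)
qed

lemma core_jumps:
  assumes "y \<in> core"
  shows "\<exists>l\<in>{k, k + 1}. jump y l"
proof -
  have "y \<in> approx (Suc 0)" using assms unfolding core_def by blast
  then show ?thesis by (simp only: approx.simps mem_Collect_eq) blast
qed

lemma towers_core_cover:
  assumes "commensurable_or_irrational" "core \<noteq> {}"
  shows "(\<Union>j\<in>{0..k}. tower core j) = UNIV"
proof -
  obtain t where t: "t \<in> core" using assms(2) by blast
  show ?thesis unfolding core_def
  proof (rule towers_cover[OF assms(1) _ _ biclosed_core[of t]])
    show "0 \<in> {n. t + of_int n * b \<in> core}" using t by simp
    show "cylinder (approx N)" "approx (Suc N) \<subseteq> approx N" for N
      by (rule cylinder_approx approx_Suc_subset)+
  qed (simp add: core_def)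
qed

section \<open>Finite-level approximations of \<open>Dset\<close>\<close>

definition double_approx :: "nat \<Rightarrow> real set" where
  "double_approx N = {s \<in> approx N. \<exists>j\<in>{1..k}. \<exists>l\<in>{k, k + 1}. jump s l \<and> j < l \<and> s + of_int j * b \<in> approx N}"

lemma cylinder_double_approx: "cylinder (double_approx N)"
proof -
  have "double_approx N = approx N \<inter>
    (\<Union>j\<in>{1..k}. \<Union>l\<in>{l \<in> {k, k + 1}. j < l}. {s. jump s l} \<inter> {s. s + of_int j * b \<in> approx N})"
    unfolding double_approx_def by blast
  also have "cylinder \<dots>"
    by (intro cylinder_Int cylinder_UNION cylinder_approx jump shift) auto
  finally show ?thesis .
qed

lemma Dset_eq_INT: "Dset a b c = (\<Inter>N. double_approx N)"
proof (intro equalityI subsetI)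
  fix s assume "s \<in> Dset a b c"
  then show "s \<in> (\<Inter>N. double_approx N)" unfolding Dset_eq core_def double_approx_def by blast
next
  fix s assume s: "s \<in> (\<Inter>N. double_approx N)"
  have "\<exists>j\<in>{1..k}. \<forall>N. (\<exists>l\<in>{k, k + 1}. jump s l \<and> j < l) \<and> s + of_int j * b \<in> approx N"
  proof (rule decseq_finite_choice)
    show "\<exists>j\<in>{1..k}. (\<exists>l\<in>{k, k + 1}. jump s l \<and> j < l) \<and> s + of_int j * b \<in> approx N" for N
      using INT_D[OF s, of N] unfolding double_approx_def by blast
  qed (use approx_Suc_subset in \<open>simp, blast\<close>)
  moreover have "s \<in> core" using s unfolding core_def double_approx_def by blast
  ultimately show "s \<in> Dset a b c" unfolding Dset_eq core_def by blast
qed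

lemma towers_Dset_cover:
  assumes "commensurable_or_irrational" "Dset a b c \<noteq> {}"
  shows "(\<Union>j\<in>{0..k}. tower (Dset a b c) j) = UNIV"
proof -
  obtain t where "t \<in> Dset a b c" using assms(2) by blast
  then obtain N where N: "0 \<in> N" "\<And>m. card (N \<inter> window t m) = 2" using Dset_iff by blast
  have bi: "biclosed t N" by (rule constant_count_biclosed[OF N(2)])
  have "t + of_int n * b \<in> Dset a b c" if "n \<in> N" for n
  proof -
    \<comment> \<open>Moving the base point to \<open>t + nb\<close> shows that every point of the
      doubly counted set lies in \<open>Dset\<close>, not only \<open>t\<close>.\<close>
    define N' where "N' = (\<lambda>l. l - n) ` N"
    have "N' \<inter> window (t + of_int n * b) m = (\<lambda>l. l - n) ` (N \<inter> window t m)" for m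
      by (auto simp: N'_def window_def algebra_simps)
    then have "card (N' \<inter> window (t + of_int n * b) m) = 2" for m
      using N(2)[of m] by (simp add: card_image inj_on_def)
    moreover have "0 \<in> N'" using that by (auto simp: N'_def)
    ultimately show ?thesis unfolding Dset_iff by (intro exI[of _ N'] conjI allI)
  qed
  moreover have "double_approx (Suc M) \<subseteq> double_approx M" for M
    using approx_Suc_subset[of M] unfolding double_approx_def by blast
  ultimately show ?thesis unfolding Dset_eq_INT
    by (intro towers_cover[OF assms(1) cylinder_double_approx _ bi N(1)]) auto
qed

section \<open>Measure of the towers\<close>

text \<open>\<open>core\<close> and \<open>Dset\<close> are countable intersections of cylinders;
  periodicity and Borel measurability are what survives in the limit.\<close>

definition periodic_borel :: "real set \<Rightarrow> bool" where
  "periodic_borel V \<longleftrightarrow> V \<in> sets borel \<and> (\<forall>x. x + a \<in> V \<longleftrightarrow> x \<in> V)"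

definition period_measure :: "real set \<Rightarrow> real" where
  "period_measure V = measure lebesgue (V \<inter> {0..<a})"

lemma cylinder_periodic_borel: "cylinder V \<Longrightarrow> periodic_borel V"
  unfolding periodic_borel_def using cylinder_borel cylinder_periodic by blast

lemma periodic_borel_INT: "(\<And>N :: nat. periodic_borel (T N)) \<Longrightarrow> periodic_borel (\<Inter>N. T N)"
  unfolding periodic_borel_def by auto

lemma periodic_borel_Int: "periodic_borel V \<Longrightarrow> periodic_borel W \<Longrightarrow> periodic_borel (V \<inter> W)"
  unfolding periodic_borel_def by auto

lemma periodic_borel_shift:
  assumes "periodic_borel V"
  shows "periodic_borel {x. x + s \<in> V}"
  unfolding periodic_borel_def
proof
  have "(\<lambda>x. x + s) -` V \<inter> space borel \<in> sets borel"
    by (rule measurable_sets[of _ borel borel]) (use assms in \<open>auto simp: periodic_borel_def\<close>)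
  then show "{x. x + s \<in> V} \<in> sets borel" by (simp add: vimage_def)
  have "x + a + s \<in> V \<longleftrightarrow> x + s \<in> V" for x
    using assms unfolding periodic_borel_def by (metis add.assoc add.commute)
  then show "\<forall>x. x + a \<in> {x. x + s \<in> V} \<longleftrightarrow> x \<in> {x. x + s \<in> V}" by simp
qed

lemma periodic_borel_lmeasurable:
  assumes "periodic_borel V"
  shows "V \<inter> {0..<a} \<in> lmeasurable"
proof (rule fmeasurableI2)
  show "{0..a} \<in> lmeasurable" by simp
qed (use assms in \<open>auto simp: periodic_borel_def\<close>)

lemma period_measure_shift:
  assumes "periodic_borel V"
  shows "period_measure {x. x + s \<in> V} = period_measure V"
  unfolding period_measure_def
  by (rule measure_period_translate[OF a_pos]) (use assms in \<open>auto simp: periodic_borel_def\<close>)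

lemma period_measure_shift_minus:
  assumes "periodic_borel V"
  shows "period_measure {x. x - s \<in> V} = period_measure V"
  using period_measure_shift[OF assms, of "- s"] by simp

lemma period_measure_UNIV: "period_measure UNIV = a"
  using a_pos by (simp add: period_measure_def)

lemma period_measure_mono:
  assumes "periodic_borel V" "periodic_borel W" "V \<subseteq> W"
  shows "period_measure V \<le> period_measure W"
  unfolding period_measure_def
  by (intro measure_mono_fmeasurable fmeasurableD periodic_borel_lmeasurable) (use assms in auto)

lemma period_measure_UN_le:
  assumes "finite J" "\<And>j. j \<in> J \<Longrightarrow> periodic_borel (V j)" "W \<subseteq> (\<Union>j\<in>J. V j)" "W \<in> sets borel"
  shows "period_measure W \<le> (\<Sum>j\<in>J. period_measure (V j))"
proof -
  have "period_measure W \<le> measure lebesgue (\<Union>j\<in>J. V j \<inter> {0..<a})"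
    unfolding period_measure_def
  proof (rule measure_mono_fmeasurable)
    show "(\<Union>j\<in>J. V j \<inter> {0..<a}) \<in> lmeasurable"
      using assms(1,2) by (intro fmeasurable.finite_UN periodic_borel_lmeasurable)
  qed (use assms in auto)
  also have "\<dots> \<le> (\<Sum>j\<in>J. period_measure (V j))"
    unfolding period_measure_def
    by (intro measure_UNION_le fmeasurableD periodic_borel_lmeasurable) (use assms in auto)
  finally show ?thesis .
qed

section \<open>Total measure of the towers\<close>

lemma tower_INT: "tower (\<Inter>N. T N) j = (\<Inter>N::nat. tower (T N) j)"
  by (auto simp: tower_def)

lemma periodic_borel_core: "periodic_borel core"
  unfolding core_def by (intro periodic_borel_INT cylinder_periodic_borel cylinder_approx)

lemma periodic_borel_Dset: "periodic_borel (Dset a b c)"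
  unfolding Dset_eq_INT by (intro periodic_borel_INT cylinder_periodic_borel cylinder_double_approx)

lemma periodic_borel_tower_core: "periodic_borel (tower core j)"
  unfolding core_def tower_INT
  by (intro periodic_borel_INT cylinder_periodic_borel cylinder_tower cylinder_approx)

lemma periodic_borel_tower_Dset: "periodic_borel (tower (Dset a b c) j)"
  unfolding Dset_eq_INT tower_INT
  by (intro periodic_borel_INT cylinder_periodic_borel cylinder_tower cylinder_double_approx)

text \<open>Every floor \<open>j < k\<close> is a full translate of \<open>core\<close>, while floor
  \<open>k\<close> carries only the points with jump \<open>k + 1\<close>. Points of jump length
  \<open>l\<close> are thus counted \<open>l\<close> times.\<close>

lemma sum_towers:
  "(\<Sum>j\<in>{0..k}. period_measure (tower core j)) =
    (of_int k + 1) * period_measure (core \<inter> {y. jump y (k + 1)}) + of_int k * period_measure (core \<inter> {y. jump y k})"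
proof -
  define S1 where "S1 = core \<inter> {y. jump y (k + 1)}"
  define S0 where "S0 = core \<inter> {y. jump y k}"
  have pb: "periodic_borel S1" "periodic_borel S0"
    unfolding S1_def S0_def
    by (intro periodic_borel_Int periodic_borel_core cylinder_periodic_borel cylinder.jump)+
  have low: "period_measure (tower core j) = period_measure core" if "j < k" for j
  proof -
    have "tower core j = {x. x - of_int j * b \<in> core}"
    proof (intro equalityI subsetI)
      fix x assume "x \<in> {x. x - of_int j * b \<in> core}"
      then have x: "x - of_int j * b \<in> core" by simp
      then obtain l where "l \<in> {k, k + 1}" "jump (x - of_int j * b) l" using core_jumps by blast
      moreover from this have "j < l" using that by auto
      ultimately show "x \<in> tower core j" using x unfolding tower_def by blast
    qed (auto simp: tower_def)
    then show ?thesis using period_measure_shift_minus[OF periodic_borel_core] by simp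
  qed
  have "tower core k = {x. x - of_int k * b \<in> S1}" by (auto simp: tower_def S1_def)
  then have high: "period_measure (tower core k) = period_measure S1"
    using period_measure_shift_minus[OF pb(1)] by simp
  have "core = S1 \<union> S0" unfolding S1_def S0_def using core_jumps by blast
  moreover have disj: "S1 \<inter> S0 = {}" unfolding S1_def S0_def using jump_unique[of _ k "k + 1"] by auto
  ultimately have "core \<inter> {0..<a} = (S1 \<inter> {0..<a}) \<union> (S0 \<inter> {0..<a})"
    "(S1 \<inter> {0..<a}) \<inter> (S0 \<inter> {0..<a}) = {}" by auto
  then have "period_measure core = period_measure S1 + period_measure S0"
    using measure_Un3[OF periodic_borel_lmeasurable[OF pb(1)] periodic_borel_lmeasurable[OF pb(2)]]
    by (simp add: period_measure_def)
  moreover have "{0..k} = insert k {0..<k}" using k_pos by auto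
  ultimately show ?thesis
    unfolding S1_def[symmetric] S0_def[symmetric]
    using k_pos by (simp add: high low algebra_simps)
qed

text \<open>If \<open>x\<close> lies on floors \<open>i < j\<close>, then \<open>x - jb\<close> has
  the companion \<open>x - ib\<close> before its successor, so it belongs to
  \<open>Dset\<close>.\<close>

lemma towers_disjoint:
  assumes "Dset a b c = {}" "0 \<le> i" "i < j" "j \<le> k"
  shows "tower core i \<inter> tower core j = {}"
proof (rule ccontr)
  assume "tower core i \<inter> tower core j \<noteq> {}"
  then obtain x where "x \<in> tower core i" "x \<in> tower core j" by blast
  then obtain l where x: "x - of_int i * b \<in> core" "x - of_int j * b \<in> core"
    "l \<in> {k, k + 1}" "jump (x - of_int j * b) l" "j < l"
    unfolding tower_def by blast
  have "x - of_int j * b + of_int (j - i) * b \<in> core" using x(1) by (simp add: algebra_simps)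
  moreover have "j - i \<in> {1..k}" "j - i < l" using assms x(5) by auto
  ultimately have "x - of_int j * b \<in> Dset a b c" unfolding Dset_eq using x by blast
  then show False using assms(1) by simp
qed

text \<open>The towers always cover a period, so their measures sum to \<open>a\<close> if they are
  disjoint. A point of \<open>Dset\<close> produces an overlap of positive measure, and the sum then
  exceeds \<open>a\<close>.\<close>

lemma sum_towers_eq_iff:
  assumes ci: "commensurable_or_irrational" and ne: "core \<noteq> {}"
  shows "Dset a b c = {} \<longleftrightarrow> (\<Sum>j\<in>{0..k}. period_measure (tower core j)) = a"
proof
  assume D: "Dset a b c = {}"
  have "measure lebesgue (\<Union>j\<in>{0..k}. tower core j \<inter> {0..<a}) =
      (\<Sum>j\<in>{0..k}. measure lebesgue (tower core j \<inter> {0..<a}))"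
  proof (rule measure_UNION')
    show "pairwise (\<lambda>i j. disjnt (tower core i \<inter> {0..<a}) (tower core j \<inter> {0..<a})) {0..k}"
      unfolding pairwise_def disjnt_def
    proof (intro ballI impI)
      fix i j assume ij: "i \<in> {0..k}" "j \<in> {0..k}" "i \<noteq> j"
      then have "tower core i \<inter> tower core j = {}"
        using towers_disjoint[OF D, of i j] towers_disjoint[OF D, of j i]
        by (cases i j rule: linorder_cases) auto
      then show "(tower core i \<inter> {0..<a}) \<inter> (tower core j \<inter> {0..<a}) = {}" by blast
    qed
  qed (auto intro: periodic_borel_lmeasurable periodic_borel_tower_core)
  moreover have "(\<Union>j\<in>{0..k}. tower core j \<inter> {0..<a}) = (\<Union>j\<in>{0..k}. tower core j) \<inter> {0..<a}" by blast
  ultimately show "(\<Sum>j\<in>{0..k}. period_measure (tower core j)) = a"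
    using period_measure_UNIV unfolding towers_core_cover[OF ci ne] period_measure_def by simp
next
  assume sum: "(\<Sum>j\<in>{0..k}. period_measure (tower core j)) = a"
  show "Dset a b c = {}"
  proof (rule ccontr)
    assume D: "Dset a b c \<noteq> {}"
    \<comment> \<open>The \<open>k + 1\<close> towers over \<open>Dset\<close> cover the line and
      each measures at most as much as \<open>Dset\<close>, so \<open>Dset\<close> cannot be
      null.\<close>
    have "period_measure UNIV \<le> (\<Sum>j\<in>{0..k}. period_measure (tower (Dset a b c) j))"
      by (rule period_measure_UN_le) (simp_all add: periodic_borel_tower_Dset towers_Dset_cover[OF ci D])
    also have "\<dots> \<le> (\<Sum>j\<in>{0..k}. period_measure (Dset a b c))"
    proof (rule sum_mono)
      fix j
      have "period_measure (tower (Dset a b c) j) \<le> period_measure {x. x + - (of_int j * b) \<in> Dset a b c}"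
        by (intro period_measure_mono periodic_borel_tower_Dset periodic_borel_shift periodic_borel_Dset)
           (auto simp: tower_def)
      then show "period_measure (tower (Dset a b c) j) \<le> period_measure (Dset a b c)"
        by (simp only: period_measure_shift[OF periodic_borel_Dset])
    qed
    also have "\<dots> = (of_int k + 1) * period_measure (Dset a b c)" using k_pos by simp
    finally have "0 < (of_int k + 1) * period_measure (Dset a b c)"
      using a_pos by (simp add: period_measure_UNIV)
    then have pos: "0 < period_measure (Dset a b c)" using k_pos by (simp add: zero_less_mult_iff)
    \<comment> \<open>If \<open>s\<close> has companion \<open>s + jb\<close>, the latter point lies
      on floor \<open>j\<close> over \<open>s\<close> and on floor 0 over itself.\<close>
    define overlap where "overlap j = tower core j \<inter> tower core 0" for j
    have pb_overlap: "periodic_borel (overlap j)" for j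
      unfolding overlap_def by (intro periodic_borel_Int periodic_borel_tower_core)
    have "Dset a b c \<subseteq> (\<Union>j\<in>{1..k}. {s. s + of_int j * b \<in> overlap j})"
    proof
      fix s assume "s \<in> Dset a b c"
      then obtain j l where s: "s \<in> core" "j \<in> {1..k}" "l \<in> {k, k + 1}" "jump s l" "j < l" "s + of_int j * b \<in> core"
        unfolding Dset_eq by blast
      obtain l' where l': "l' \<in> {k, k + 1}" "jump (s + of_int j * b) l'" using core_jumps[OF s(6)] by blast
      then have "0 < l'" using k_pos by auto
      then have "s + of_int j * b \<in> overlap j"
        using s l' unfolding overlap_def tower_def by (simp only: Int_iff mem_Collect_eq add_diff_cancel_right' of_int_0 mult_zero_left diff_zero) blast
      then show "s \<in> (\<Union>j\<in>{1..k}. {s. s + of_int j * b \<in> overlap j})" using s(2) by blast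
    qed
    then have "period_measure (Dset a b c) \<le> (\<Sum>j\<in>{1..k}. period_measure {s. s + of_int j * b \<in> overlap j})"
      by (intro period_measure_UN_le periodic_borel_shift pb_overlap)
         (use periodic_borel_Dset in \<open>auto simp: periodic_borel_def\<close>)
    also have "\<dots> = (\<Sum>j\<in>{1..k}. period_measure (overlap j))"
      by (simp only: period_measure_shift[OF pb_overlap])
    finally have "\<not> (\<Sum>j\<in>{1..k}. period_measure (overlap j)) \<le> 0" using pos by simp
    then obtain j where j: "j \<in> {1..k}" "0 < period_measure (overlap j)"
      by (meson not_le sum_nonpos)
    \<comment> \<open>Inclusion-exclusion is applied to floors 0 and \<open>j\<close>, subadditivity
      to the remaining floors.\<close>
    define J where "J = {0..k} - {0, j}"
    have Jeq: "{0..k} = insert 0 (insert j J)" "finite J" "0 \<notin> insert j J" "j \<notin> J"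
      using j(1) by (auto simp: J_def)
    have "a = measure lebesgue ((\<Union>j\<in>{0..k}. tower core j) \<inter> {0..<a})"
      using period_measure_UNIV unfolding towers_core_cover[OF ci ne] period_measure_def by simp
    also have "(\<Union>j\<in>{0..k}. tower core j) \<inter> {0..<a} =
       ((tower core 0 \<inter> {0..<a}) \<union> (tower core j \<inter> {0..<a})) \<union> (\<Union>i\<in>J. tower core i \<inter> {0..<a})"
      unfolding Jeq(1) by blast
    also have "measure lebesgue \<dots> \<le> measure lebesgue ((tower core 0 \<inter> {0..<a}) \<union> (tower core j \<inter> {0..<a}))
       + measure lebesgue (\<Union>i\<in>J. tower core i \<inter> {0..<a})"
      by (intro measure_Un_le sets.Un sets.finite_UN Jeq(2) fmeasurableD
          periodic_borel_lmeasurable periodic_borel_tower_core)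
    also have "measure lebesgue ((tower core 0 \<inter> {0..<a}) \<union> (tower core j \<inter> {0..<a})) =
       period_measure (tower core 0) + period_measure (tower core j)
       - measure lebesgue ((tower core 0 \<inter> {0..<a}) \<inter> (tower core j \<inter> {0..<a}))"
      unfolding period_measure_def
      by (intro measure_Un3 periodic_borel_lmeasurable periodic_borel_tower_core)
    also have "(tower core 0 \<inter> {0..<a}) \<inter> (tower core j \<inter> {0..<a}) = overlap j \<inter> {0..<a}" unfolding overlap_def by blast
    also have "measure lebesgue (\<Union>i\<in>J. tower core i \<inter> {0..<a}) \<le> (\<Sum>i\<in>J. period_measure (tower core i))"
      unfolding period_measure_def
      by (intro measure_UNION_le Jeq(2) fmeasurableD periodic_borel_lmeasurable periodic_borel_tower_core)
    finally have "a + period_measure (overlap j) \<le> (\<Sum>i\<in>{0..k}. period_measure (tower core i))"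
      unfolding Jeq(1) using Jeq(2-4) by (simp add: period_measure_def[of "overlap j"])
    then show False using sum j(2) by simp
  qed
qed

text \<open>On \<open>[0, a)\<close> a jump means \<open>c \<le> y + jb < c + a\<close>. For
  \<open>j = k + 1\<close> only the upper bound restricts \<open>y\<close>, for \<open>j = k\<close>
  only the lower one.\<close>

lemma core_jump_Int_period:
  "core \<inter> {y. jump y (k + 1)} \<inter> {0..<a} = core \<inter> {0..<c - of_int k * b + a - b}"
  "core \<inter> {y. jump y k} \<inter> {0..<a} = core \<inter> {c - of_int k * b..<a}"
proof -
  have "jump y j \<longleftrightarrow> 0 \<le> y + of_int j * b - c \<and> y + of_int j * b - c < a" if "0 \<le> y" "y < a" for y j
  proof -
    have "\<lfloor>y / a\<rfloor> = 0" using that floor_divide_eq_iff[OF a_pos, of y 0] by simp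
    then show ?thesis
      unfolding jump_def using floor_divide_eq_iff[OF a_pos, of "y + of_int j * b - c" 0] by simp
  qed
  then show "core \<inter> {y. jump y (k + 1)} \<inter> {0..<a} = core \<inter> {0..<c - of_int k * b + a - b}"
    "core \<inter> {y. jump y k} \<inter> {0..<a} = core \<inter> {c - of_int k * b..<a}"
    using c0_less c0_gt a_less_b a_pos by (auto simp: algebra_simps)
qed

end

theorem theorem5p4:
  fixes a b c :: real
  defines "k \<equiv> \<lfloor>c / b\<rfloor>"
  defines "c0 \<equiv> c - of_int k * b"
  defines "c1 \<equiv> of_int k * b - of_int \<lfloor>of_int k * b / a\<rfloor> * a"
  assumes "0 < a" and "a < b" and "b < c"
    and "b - a < c0" and "c0 < a"
    and "0 < c1" and "c1 < 2 * a - b"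
    and "k \<ge> 2"
    and "Sset a b c \<noteq> {}"
    and "a / b \<notin> \<rat> \<or>
         (\<exists>p q :: int. p > 0 \<and> q > 0 \<and> coprime p q \<and> a / b = of_int p / of_int q
            \<and> (\<exists>z :: int. c / b = of_int z / of_int q))"
  shows "Dset a b c = {} \<longleftrightarrow>
    (of_int k + 1) * measure lebesgue (Sset a b c \<inter> {0..<c0 + a - b})
      + of_int k * measure lebesgue (Sset a b c \<inter> {c0..<a}) = a"
proof -
  interpret window_count a b c k
    by unfold_locales (use assms in \<open>auto simp: c0_def\<close>)
  have "commensurable_or_irrational"
    unfolding commensurable_or_irrational_def using assms by blast
  moreover have "core \<noteq> {}" using assms Sset_eq_core by simp
  ultimately show ?thesis
    using sum_towers_eq_iff sum_towers
    unfolding Sset_eq_core period_measure_def core_jump_Int_period c0_def by simp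
qed

end
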